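(* Let $G$ be an acyclic network with sources $\mathcal S$, destinations $\mathcal T$ and a connection set $\mathcal C$, and let $M=\{M_{i,j}\}$, where $M_{i,j}$ is the system matrix from the source processes $\mathcal X(S_i)$ to the destination processes $\mathcal Z(T_j)$. Then $(G,\mathcal C)$ is solvable if there exists an assignment of the coefficients $\alpha_{(i,e_j)}$, $\epsilon_{(e_i,(T_j,k))}$, $\beta_{(e_i,e_j)}$ such that: 1. $M_{i,j}=0$ for all pairs $(i,j)$ with $(S_i,T_j,\mathcal X(S_i,T_j))\notin\mathcal C$ (i.e. there is no connection from $S_i$ to $T_j$ in $\mathcal C$); and 2. for every destination $T_j$, if $(S_{\sigma(i)},T_j,\mathcal X(S_{\sigma(i)},T_j))\in\mathcal C$, $i\in[1,K(j)]$, are the connections with $T_j$ as receiver, then $[M_{\sigma(1),j}^T,M_{\sigma(2),j}^T,\dots,M_{\sigma(K(j)),j}^T]$ is a $|\mathcal Z(T_j)|\times|\mathcal Z(T_j)|$ nonsingular matrix.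
   Context: Network. $G=(\mathcal V,\mathcal E)$ consists of a finite set $\mathcal V$ of nodes; each node $V$ has a finite set $I(V)$ of input ports and a finite set $O(V)$ of output ports (all pairwise disjoint). Each edge in $\mathcal E$ is an ordered pair $(e_1,e_2)$ with $e_1\in O(V_1)$ and $e_2\in I(V_2)$ for some $V_1,V_2\in\mathcal V$. $G$ is acyclic if the directed graph on $\mathcal V$ with an arc $V_1\to V_2$ whenever some edge goes from $O(V_1)$ to $I(V_2)$ has no directed cycle. Linear transmission over a finite field $\mathbb F_q$. Each source $S_i\in\mathcal S$ has a row vector of symbols $\mathcal X(S_i)=[X(S_i,1),\dots,X(S_i,\mu(S_i))]$, $\mu(S_i)\le|O(S_i)|$, all source symbols being independent. $Y(e)$ denotes the symbol at port $e$. For $e\in O(V)$: $Y(e)=\sum_{e'\in I(V)}\beta_{(e',e)}Y(e')$, plus $\sum_k\alpha_{(k,e)}X(V,k)$ if $V\in\mathcal S$. For an input port $e'$: $Y(e')=\sum_{(e,e')\in\mathcal E}Y(e)$. A destination $T_j\in\mathcal T$ forms $Z(T_j,k)=\sum_{e'\in I(T_j)}\epsilon_{(e',(T_j,k))}Y(e')$, $1\le k\le\nu(T_j)$, and $\mathcal Z(T_j)=[Z(T_j,1),\dots,Z(T_j,\nu(T_j))]$, $|\mathcal Z(T_j)|=\nu(T_j)$. The coefficients $\alpha,\beta,\epsilon$ and the numbers $\nu(T_j)$ are free. The $\mu(S_i)\times\nu(T_j)$ matrices $M_{i,j}$ are determined by $\mathcal Z(T_j)=\sum_i\mathcal X(S_i)M_{i,j}$.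 Connections. A connection is a triple $(S,T,\mathcal X(S,T))$ with $S\in\mathcal S$, $T\in\mathcal T$, $\mathcal X(S,T)\subseteq\mathcal X(S)$ (at most one connection per pair $(S,T)$); it is established if the processes of $\mathcal X(S,T)$ are among the components of $\mathcal Z(T)$, for all values of the source symbols. $(G,\mathcal C)$ is solvable if the coefficients can be chosen so that all connections in $\mathcal C$ are established simultaneously. *)

theory Defs
  imports "Jordan_Normal_Form.Matrix"
begin

record ('v, 'p) network =
  nodes :: "'v set"
  in_ports :: "'v \<Rightarrow> 'p set"
  out_ports :: "'v \<Rightarrow> 'p set"
  edges :: "('p \<times> 'p) set"
  sources :: "'v set"
  dests :: "'v set"
  mu :: "'v \<Rightarrow> nat"

definition is_network :: "('v, 'p) network \<Rightarrow> bool" where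
  "is_network G \<longleftrightarrow>
     finite (nodes G) \<and>
     (\<forall>V\<in>nodes G. finite (in_ports G V) \<and> finite (out_ports G V)) \<and>
     (\<forall>V\<in>nodes G. \<forall>W\<in>nodes G. in_ports G V \<inter> out_ports G W = {}) \<and>
     (\<forall>V\<in>nodes G. \<forall>W\<in>nodes G. V \<noteq> W \<longrightarrow>
        in_ports G V \<inter> in_ports G W = {} \<and> out_ports G V \<inter> out_ports G W = {}) \<and>
     edges G \<subseteq> (\<Union>V\<in>nodes G. out_ports G V) \<times> (\<Union>V\<in>nodes G. in_ports G V) \<and>
     sources G \<subseteq> nodes G \<and> dests G \<subseteq> nodes G \<and>
     (\<forall>S\<in>sources G. mu G S \<le> card (out_ports G S))"

definition node_arcs :: "('v, 'p) network \<Rightarrow> ('v \<times> 'v) set" where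
  "node_arcs G = {(V, W). V \<in> nodes G \<and> W \<in> nodes G \<and>
     (\<exists>(e1, e2)\<in>edges G. e1 \<in> out_ports G V \<and> e2 \<in> in_ports G W)}"

definition acyclic_network :: "('v, 'p) network \<Rightarrow> bool" where
  "acyclic_network G \<longleftrightarrow> is_network G \<and> acyclic (node_arcs G)"

text \<open>Processes are numbered from 0: the source symbols of \<open>S\<close> are \<open>X S k\<close> for \<open>k < mu G S\<close>,
  the components formed at \<open>T\<close> are those with index \<open>k < nu c T\<close>. The first argument of
  \<open>alpha\<close> is the index of a source process; the source itself is the node owning the port.\<close>

record ('v, 'p, 'f) coeffs =
  alpha :: "nat \<Rightarrow> 'p \<Rightarrow> 'f"
  beta :: "'p \<Rightarrow> 'p \<Rightarrow> 'f"
  eps :: "'p \<Rightarrow> 'v \<Rightarrow> nat \<Rightarrow> 'f"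
  nu :: "'v \<Rightarrow> nat"

text \<open>\<open>transmission G c X Y\<close>: the port symbols \<open>Y\<close> satisfy the network equations for the source
  symbols \<open>X\<close>. On an acyclic network such a \<open>Y\<close> exists and is unique on the ports; see
  \<open>transmission_exists\<close> and \<open>transmission_unique\<close> below.\<close>

definition transmission ::
  "('v, 'p) network \<Rightarrow> ('v, 'p, 'f::{finite, field}) coeffs \<Rightarrow> ('v \<Rightarrow> nat \<Rightarrow> 'f) \<Rightarrow> ('p \<Rightarrow> 'f) \<Rightarrow> bool"
where
  "transmission G c X Y \<longleftrightarrow>
     (\<forall>V\<in>nodes G.
        (\<forall>e\<in>out_ports G V.
           Y e = (\<Sum>e'\<in>in_ports G V. beta c e' e * Y e')
               + (if V \<in> sources G then \<Sum>k<mu G V. alpha c k e * X V k else 0)) \<and>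
        (\<forall>e'\<in>in_ports G V. Y e' = (\<Sum>e | (e, e') \<in> edges G. Y e)))"

definition dest_symbol ::
  "('v, 'p) network \<Rightarrow> ('v, 'p, 'f::{finite, field}) coeffs \<Rightarrow> ('p \<Rightarrow> 'f) \<Rightarrow> 'v \<Rightarrow> nat \<Rightarrow> 'f"
where
  "dest_symbol G c Y T k = (\<Sum>e'\<in>in_ports G T. eps c e' T k * Y e')"

text \<open>\<open>M S T\<close> is the system matrix from \<open>S\<close> to \<open>T\<close>; on an acyclic network the family exists and is
  unique; see \<open>system_matrices_exist\<close> and \<open>system_matrices_unique\<close> below.\<close>

definition system_matrices ::
  "('v, 'p) network \<Rightarrow> ('v, 'p, 'f::{finite, field}) coeffs \<Rightarrow> ('v \<Rightarrow> 'v \<Rightarrow> 'f mat) \<Rightarrow> bool"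
where
  "system_matrices G c M \<longleftrightarrow>
     (\<forall>S\<in>sources G. \<forall>T\<in>dests G. M S T \<in> carrier_mat (mu G S) (nu c T)) \<and>
     (\<forall>X Y. transmission G c X Y \<longrightarrow>
        (\<forall>T\<in>dests G. \<forall>l<nu c T.
           dest_symbol G c Y T l = (\<Sum>S\<in>sources G. \<Sum>k<mu G S. X S k * M S T $$ (k, l))))"

text \<open>A connection \<open>(S, T, A)\<close> requests at \<open>T\<close> the processes \<open>X S k\<close> with \<open>k \<in> A\<close>.\<close>

type_synonym 'v connection = "'v \<times> 'v \<times> nat set"

definition connection_set :: "('v, 'p) network \<Rightarrow> 'v connection set \<Rightarrow> bool" where
  "connection_set G C \<longleftrightarrow>
     (\<forall>(S, T, A)\<in>C. S \<in> sources G \<and> T \<in> dests G \<and> A \<subseteq> {..<mu G S}) \<and>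
     (\<forall>S T A B. (S, T, A) \<in> C \<longrightarrow> (S, T, B) \<in> C \<longrightarrow> A = B)"

text \<open>The position \<open>l\<close> at which a process appears may not depend on the values of the source
  symbols.\<close>

fun established ::
  "('v, 'p) network \<Rightarrow> ('v, 'p, 'f::{finite, field}) coeffs \<Rightarrow> 'v connection \<Rightarrow> bool"
where
  "established G c (S, T, A) \<longleftrightarrow>
     (\<forall>k\<in>A. \<exists>l<nu c T. \<forall>X Y. transmission G c X Y \<longrightarrow> dest_symbol G c Y T l = X S k)"

definition solvable ::
  "'f::{finite, field} itself \<Rightarrow> ('v, 'p) network \<Rightarrow> 'v connection set \<Rightarrow> bool"
where
  "solvable _ G C \<longleftrightarrow> (\<exists>c :: ('v, 'p, 'f) coeffs. \<forall>x\<in>C. established G c x)"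

text \<open>The block matrix \<open>[M\<^sub>1\<^sup>T, \<dots>, M\<^sub>K\<^sup>T]\<close>, where each \<open>M\<^sub>i\<close> has \<open>n\<close> columns.\<close>

definition transposed_blocks :: "nat \<Rightarrow> 'f mat list \<Rightarrow> 'f mat" where
  "transposed_blocks n Ms = mat_of_cols n (concat (map (\<lambda>M. cols (transpose_mat M)) Ms))"


subsection \<open>Well-definedness of transmissions and system matrices\<close>

definition port_rel :: "('v, 'p) network \<Rightarrow> ('p \<times> 'p) set" where
  "port_rel G = {(e', e). \<exists>V\<in>nodes G. e' \<in> in_ports G V \<and> e \<in> out_ports G V} \<union> edges G"

lemma wf_port_rel:
  assumes "acyclic_network G"
  shows "wf (port_rel G)"
proof -
  have net: "is_network G" and acyc: "acyclic (node_arcs G)"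
    using assms by (auto simp: acyclic_network_def)
  have "node_arcs G \<subseteq> nodes G \<times> nodes G" by (auto simp: node_arcs_def)
  moreover have "finite (nodes G)" using net by (simp add: is_network_def)
  ultimately have "finite (node_arcs G)" by (meson finite_SigmaI finite_subset)
  then have wf: "wf (node_arcs G)" using acyc by (rule finite_acyclic_wf)
  define own where "own = (\<lambda>p. SOME V. V \<in> nodes G \<and> p \<in> in_ports G V \<union> out_ports G V)"
  have own: "own p = V" if "V \<in> nodes G" "p \<in> in_ports G V \<union> out_ports G V" for p V
  proof -
    have "own p \<in> nodes G \<and> p \<in> in_ports G (own p) \<union> out_ports G (own p)"
      unfolding own_def by (rule someI_ex) (use that in blast)
    then show ?thesis using that net unfolding is_network_def by blast
  qed
  define h where "h = (\<lambda>p. if p \<in> (\<Union>V\<in>nodes G. out_ports G V) then 1 else 0 :: nat)"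
  have "port_rel G \<subseteq> inv_image (node_arcs G <*lex*> less_than) (\<lambda>p. (own p, h p))"
  proof clarify
    fix p q assume "(p, q) \<in> port_rel G"
    then consider (node) V where "V \<in> nodes G" "p \<in> in_ports G V" "q \<in> out_ports G V"
      | (edge) "(p, q) \<in> edges G"
      by (auto simp: port_rel_def)
    then show "(p, q) \<in> inv_image (node_arcs G <*lex*> less_than) (\<lambda>p. (own p, h p))"
    proof cases
      case node
      have "own p = V" "own q = V" using own node by auto
      moreover have "h p = 0" "h q = 1"
        using node net unfolding h_def is_network_def by auto
      ultimately show ?thesis by (simp add: inv_image_def)
    next
      case edge
      then obtain V W where VW: "V \<in> nodes G" "p \<in> out_ports G V" "W \<in> nodes G" "q \<in> in_ports G W"
        using net unfolding is_network_def by blast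
      then have "own p = V" "own q = W" using own by auto
      moreover have "(V, W) \<in> node_arcs G" using VW edge by (auto simp: node_arcs_def)
      ultimately show ?thesis by (simp add: inv_image_def)
    qed
  qed
  then show ?thesis
    using wf_subset wf_inv_image wf_lex_prod wf wf_less_than by metis
qed

lemma transmission_exists:
  fixes c :: "('v, 'p, 'f::{finite, field}) coeffs"
  assumes "acyclic_network G"
  shows "\<exists>Y. transmission G c X Y"
proof -
  have net: "is_network G" using assms by (simp add: acyclic_network_def)
  define own where "own = (\<lambda>p. THE V. V \<in> nodes G \<and> p \<in> out_ports G V)"
  have own: "own p = V" if "V \<in> nodes G" "p \<in> out_ports G V" for p V
    unfolding own_def
  proof (rule the_equality)
    show "W = V" if "W \<in> nodes G \<and> p \<in> out_ports G W" for W
      using that \<open>V \<in> nodes G\<close> \<open>p \<in> out_ports G V\<close> net unfolding is_network_def by blast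
  qed (use that in simp)
  define F :: "('p \<Rightarrow> 'f) \<Rightarrow> 'p \<Rightarrow> 'f" where
    "F = (\<lambda>Y p. if p \<in> (\<Union>V\<in>nodes G. out_ports G V)
        then (\<Sum>e'\<in>in_ports G (own p). beta c e' p * Y e')
           + (if own p \<in> sources G then \<Sum>k<mu G (own p). alpha c k p * X (own p) k else 0)
        else (\<Sum>e | (e, p) \<in> edges G. Y e))"
  define Y where "Y = wfrec (port_rel G) F"
  have Y: "Y p = F (cut Y (port_rel G) p) p" for p
    unfolding Y_def by (rule wfrec[OF wf_port_rel[OF assms]])
  have "transmission G c X Y"
    unfolding transmission_def
  proof (intro ballI conjI)
    fix V e assume V: "V \<in> nodes G" and e: "e \<in> out_ports G V"
    have "cut Y (port_rel G) e e' = Y e'" if "e' \<in> in_ports G V" for e'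
      using V e that by (intro cut_apply) (auto simp: port_rel_def)
    then show "Y e = (\<Sum>e'\<in>in_ports G V. beta c e' e * Y e')
               + (if V \<in> sources G then \<Sum>k<mu G V. alpha c k e * X V k else 0)"
      by (subst Y) (use own[OF V e] V e in \<open>auto simp: F_def\<close>)
  next
    fix V e' assume V: "V \<in> nodes G" and e': "e' \<in> in_ports G V"
    have "e' \<notin> (\<Union>V\<in>nodes G. out_ports G V)"
      using V e' net unfolding is_network_def by blast
    moreover have "cut Y (port_rel G) e' e = Y e" if "(e, e') \<in> edges G" for e
      using that by (intro cut_apply) (auto simp: port_rel_def)
    ultimately show "Y e' = (\<Sum>e | (e, e') \<in> edges G. Y e)"
      by (subst Y) (simp add: F_def)
  qed
  then show ?thesis by blast
qed

lemma transmission_unique: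
  assumes "acyclic_network G" "transmission G c X Y" "transmission G c X Y'"
    and "V \<in> nodes G" "p \<in> in_ports G V \<union> out_ports G V"
  shows "Y p = Y' p"
proof -
  have net: "is_network G" using assms by (simp add: acyclic_network_def)
  have "\<forall>V\<in>nodes G. p \<in> in_ports G V \<union> out_ports G V \<longrightarrow> Y p = Y' p" for p
  proof (induction p rule: wf_induct_rule[OF wf_port_rel[OF assms(1)]])
    case (1 p)
    show ?case
    proof (intro ballI impI)
      fix V assume V: "V \<in> nodes G" and "p \<in> in_ports G V \<union> out_ports G V"
      then consider (i) "p \<in> in_ports G V" | (o) "p \<in> out_ports G V" by blast
      then show "Y p = Y' p"
      proof cases
        case i
        have "Y e = Y' e" if "(e, p) \<in> edges G" for e
          using 1[of e] that net unfolding port_rel_def is_network_def by blast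
        then have "(\<Sum>e | (e, p) \<in> edges G. Y e) = (\<Sum>e | (e, p) \<in> edges G. Y' e)" by simp
        then show ?thesis using assms(2,3) V i by (simp add: transmission_def)
      next
        case o
        have "Y e = Y' e" if "e \<in> in_ports G V" for e
          using 1[of e] that V o unfolding port_rel_def by blast
        then have "(\<Sum>e\<in>in_ports G V. beta c e p * Y e) = (\<Sum>e\<in>in_ports G V. beta c e p * Y' e)"
          by simp
        then show ?thesis using assms(2,3) V o by (simp add: transmission_def)
      qed
    qed
  qed
  then show ?thesis using assms(4,5) by blast
qed

lemma dest_symbol_unique:
  assumes "acyclic_network G" "transmission G c X Y" "transmission G c X Y'" "T \<in> dests G"
  shows "dest_symbol G c Y T l = dest_symbol G c Y' T l"
  unfolding dest_symbol_def
proof (rule sum.cong)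
  fix e assume "e \<in> in_ports G T"
  moreover have "T \<in> nodes G"
    using assms(1,4) by (auto simp: acyclic_network_def is_network_def)
  ultimately show "eps c e T l * Y e = eps c e T l * Y' e"
    using transmission_unique[OF assms(1-3)] by simp
qed simp

lemma transmission_sum:
  fixes c :: "('v, 'p, 'f::{finite, field}) coeffs"
  assumes "finite I" "\<And>i. i \<in> I \<Longrightarrow> transmission G c (X i) (Y i)"
  shows "transmission G c (\<lambda>S k. \<Sum>i\<in>I. a i * X i S k) (\<lambda>p. \<Sum>i\<in>I. a i * Y i p)"
  unfolding transmission_def
proof (intro ballI conjI)
  fix V e assume V: "V \<in> nodes G" and e: "e \<in> out_ports G V"
  have "(\<Sum>i\<in>I. a i * Y i e) = (\<Sum>i\<in>I. a i * ((\<Sum>e'\<in>in_ports G V. beta c e' e * Y i e')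
      + (if V \<in> sources G then \<Sum>k<mu G V. alpha c k e * X i V k else 0)))"
    using assms(2) V e by (intro sum.cong) (auto simp: transmission_def)
  also have "\<dots> = (\<Sum>i\<in>I. \<Sum>e'\<in>in_ports G V. beta c e' e * (a i * Y i e'))
      + (if V \<in> sources G then \<Sum>i\<in>I. \<Sum>k<mu G V. alpha c k e * (a i * X i V k) else 0)"
    by (simp add: distrib_left sum.distrib sum_distrib_left mult.left_commute)
  also have "(\<Sum>i\<in>I. \<Sum>e'\<in>in_ports G V. beta c e' e * (a i * Y i e'))
      = (\<Sum>e'\<in>in_ports G V. \<Sum>i\<in>I. beta c e' e * (a i * Y i e'))"
    by (rule sum.swap)
  also have "(\<Sum>i\<in>I. \<Sum>k<mu G V. alpha c k e * (a i * X i V k))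
      = (\<Sum>k<mu G V. \<Sum>i\<in>I. alpha c k e * (a i * X i V k))"
    by (rule sum.swap)
  finally show "(\<Sum>i\<in>I. a i * Y i e) = (\<Sum>e'\<in>in_ports G V. beta c e' e * (\<Sum>i\<in>I. a i * Y i e'))
      + (if V \<in> sources G then \<Sum>k<mu G V. alpha c k e * (\<Sum>i\<in>I. a i * X i V k) else 0)"
    by (simp add: sum_distrib_left)
next
  fix V e' assume V: "V \<in> nodes G" and e': "e' \<in> in_ports G V"
  have "(\<Sum>i\<in>I. a i * Y i e') = (\<Sum>i\<in>I. a i * (\<Sum>e | (e, e') \<in> edges G. Y i e))"
    using assms(2) V e' by (intro sum.cong) (auto simp: transmission_def)
  also have "\<dots> = (\<Sum>e | (e, e') \<in> edges G. \<Sum>i\<in>I. a i * Y i e)"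
    by (simp add: sum_distrib_left) (rule sum.swap)
  finally show "(\<Sum>i\<in>I. a i * Y i e') = (\<Sum>e | (e, e') \<in> edges G. \<Sum>i\<in>I. a i * Y i e)" .
qed

definition unit_symbols :: "'v \<Rightarrow> nat \<Rightarrow> 'v \<Rightarrow> nat \<Rightarrow> 'f::{finite, field}" where
  "unit_symbols S k = (\<lambda>S' k'. if S' = S \<and> k' = k then 1 else 0)"

lemma sum_unit_symbols:
  assumes "finite A" "S \<in> A" "k < m S"
  shows "(\<Sum>S'\<in>A. \<Sum>k'<m S'. f S' k' * unit_symbols S' k' S k) = f S k"
    and "(\<Sum>S'\<in>A. \<Sum>k'<m S'. unit_symbols S k S' k' * f S' k') = f S k"
proof -
  have "(\<Sum>k'<m S'. f S' k' * unit_symbols S' k' S k) = (if S' = S then f S k else 0)" for S'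
    using assms(3) by (simp add: unit_symbols_def if_distrib[of "(*) _"] eq_commute[of k] cong: if_cong)
  then show "(\<Sum>S'\<in>A. \<Sum>k'<m S'. f S' k' * unit_symbols S' k' S k) = f S k"
    using assms by simp
  have "(\<Sum>k'<m S'. unit_symbols S k S' k' * f S' k') = (if S' = S then f S k else 0)" for S'
    using assms(3) by (simp add: unit_symbols_def if_distrib[of "\<lambda>x. x * _"] cong: if_cong)
  then show "(\<Sum>S'\<in>A. \<Sum>k'<m S'. unit_symbols S k S' k' * f S' k') = f S k"
    using assms by simp
qed

lemma transmission_cong:
  assumes "transmission G c X Y" "\<And>S k. S \<in> sources G \<Longrightarrow> k < mu G S \<Longrightarrow> X S k = X' S k"
  shows "transmission G c X' Y"
proof -
  have "(\<Sum>k<mu G V. alpha c k e * X V k) = (\<Sum>k<mu G V. alpha c k e * X' V k)"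
    if "V \<in> sources G" for V e
    using assms(2) that by (intro sum.cong) auto
  then show ?thesis using assms(1) unfolding transmission_def by (auto cong: if_cong)
qed

lemma system_matrices_exist:
  fixes c :: "('v, 'p, 'f::{finite, field}) coeffs"
  assumes "acyclic_network G"
  shows "\<exists>M. system_matrices G c M"
proof -
  have fin: "finite (sources G)"
    using assms by (auto simp: acyclic_network_def is_network_def intro: finite_subset)
  define U where "U = (\<lambda>S k. SOME Y. transmission G c (unit_symbols S k) Y)"
  have U: "transmission G c (unit_symbols S k) (U S k)" for S k
    using someI_ex[OF transmission_exists[OF assms]] unfolding U_def by blast
  define M where "M = (\<lambda>S T. mat (mu G S) (nu c T) (\<lambda>(k, l). dest_symbol G c (U S k) T l))"
  have "dest_symbol G c Y T l = (\<Sum>S\<in>sources G. \<Sum>k<mu G S. X S k * M S T $$ (k, l))"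
    if Y: "transmission G c X Y" and T: "T \<in> dests G" and l: "l < nu c T" for X Y T l
  proof -
    let ?I = "SIGMA S:sources G. {..<mu G S}"
    have finI: "finite ?I" using fin by auto
    have "transmission G c (\<lambda>S' k'. \<Sum>i\<in>?I. X (fst i) (snd i) * unit_symbols (fst i) (snd i) S' k')
        (\<lambda>p. \<Sum>i\<in>?I. X (fst i) (snd i) * U (fst i) (snd i) p)"
      by (rule transmission_sum[OF finI]) (rule U)
    then have "transmission G c X (\<lambda>p. \<Sum>i\<in>?I. X (fst i) (snd i) * U (fst i) (snd i) p)"
    proof (rule transmission_cong)
      fix S k assume "S \<in> sources G" "k < mu G S"
      then show "(\<Sum>i\<in>?I. X (fst i) (snd i) * unit_symbols (fst i) (snd i) S k) = X S k"
        using sum_unit_symbols(1)[OF fin, of S k "mu G" X] fin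
        by (subst (asm) sum.Sigma) (auto simp: case_prod_unfold)
    qed
    then have "dest_symbol G c Y T l
        = dest_symbol G c (\<lambda>p. \<Sum>i\<in>?I. X (fst i) (snd i) * U (fst i) (snd i) p) T l"
      using dest_symbol_unique[OF assms Y _ T] by blast
    also have "\<dots> = (\<Sum>i\<in>?I. X (fst i) (snd i) * dest_symbol G c (U (fst i) (snd i)) T l)"
      unfolding dest_symbol_def
      by (simp add: sum_distrib_left mult.left_commute) (rule sum.swap)
    also have "\<dots> = (\<Sum>S\<in>sources G. \<Sum>k<mu G S. X S k * dest_symbol G c (U S k) T l)"
      using fin by (subst sum.Sigma) (auto simp: case_prod_unfold)
    also have "\<dots> = (\<Sum>S\<in>sources G. \<Sum>k<mu G S. X S k * M S T $$ (k, l))"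
      using l by (intro sum.cong) (auto simp: M_def)
    finally show ?thesis .
  qed
  then have "system_matrices G c M"
    by (auto simp: system_matrices_def M_def)
  then show ?thesis by blast
qed

lemma system_matrices_unique:
  fixes c :: "('v, 'p, 'f::{finite, field}) coeffs"
  assumes "acyclic_network G" "system_matrices G c M" "system_matrices G c N"
    and S: "S \<in> sources G" and T: "T \<in> dests G"
  shows "M S T = N S T"
proof (rule eq_matI)
  have fin: "finite (sources G)"
    using assms(1) by (auto simp: acyclic_network_def is_network_def intro: finite_subset)
  have dM: "M S T \<in> carrier_mat (mu G S) (nu c T)" and dN: "N S T \<in> carrier_mat (mu G S) (nu c T)"
    using assms by (auto simp: system_matrices_def)
  then show "dim_row (M S T) = dim_row (N S T)" "dim_col (M S T) = dim_col (N S T)" by auto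
  fix k l assume "k < dim_row (N S T)" "l < dim_col (N S T)"
  then have kl: "k < mu G S" "l < nu c T" using dN by auto
  obtain Y where Y: "transmission G c (unit_symbols S k) Y"
    using transmission_exists[OF assms(1)] by blast
  have "dest_symbol G c Y T l = L S T $$ (k, l)" if "system_matrices G c L" for L
    using that Y T kl sum_unit_symbols(2)[OF fin S, of k "mu G" "\<lambda>S k. L S T $$ (k, l)"]
    unfolding system_matrices_def by auto
  then show "M S T $$ (k, l) = N S T $$ (k, l)" using assms(2,3) by metis
qed

end

theory Submission
  imports Defs
begin

text \<open>By condition 1 only the connected sources contribute to the symbols formed at \<open>T\<close>, so these
  are the image of the concatenated source vectors under the square matrix of condition 2.
  Composing the decoding coefficients \<open>eps\<close> with its inverse makes the components at \<open>T\<close> exactly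
  the source processes of the connected sources, in particular the requested ones.\<close>

text \<open>The inverse of \<open>A\<close> serves as \<open>B\<close>: after exchanging the two
  sums, the inner one is an entry of \<open>B * A\<close>, the identity. \<open>B\<close> is chosen
  before \<open>x\<close>, so it can later act as a fixed decoding matrix for all source symbols;
  the explicit sums match the form of \<open>dest_symbol\<close>.\<close>

lemma invertible_mat_solve:
  fixes A :: "'a::field mat"
  assumes A: "A \<in> carrier_mat n n" and inv: "invertible_mat A"
  shows "\<exists>B. \<forall>x. \<forall>j<n. (\<Sum>l<n. B $$ (j, l) * (\<Sum>i<n. A $$ (l, i) * x i)) = x j"
proof -
  obtain B where AB: "A * B = 1\<^sub>m n" and BA: "B * A = 1\<^sub>m (dim_row B)"
    using A inv by (auto simp: invertible_mat_def inverts_mat_def)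
  \<comment> \<open>The two inverse equations fix the shape of \<open>B\<close>: comparing column
    counts in the first gives \<open>dim_col B\<close>, in the second
    \<open>dim_row B\<close>.\<close>
  have "dim_col B = n" "dim_row B = n"
    using arg_cong[OF AB, of dim_col] arg_cong[OF BA, of dim_col] A by auto
  then have B: "B \<in> carrier_mat n n" by auto
  have "(\<Sum>l<n. B $$ (j, l) * (\<Sum>i<n. A $$ (l, i) * x i)) = x j" if j: "j < n" for x j
  proof -
    have entry: "(\<Sum>l<n. B $$ (j, l) * A $$ (l, i)) = (if i = j then 1 else 0)" if "i < n" for i
    proof -
      have "(\<Sum>l<n. B $$ (j, l) * A $$ (l, i)) = (B * A) $$ (j, i)"
        using A B that j by (simp add: scalar_prod_def atLeast0LessThan)
      then show ?thesis using BA B that j by auto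
    qed
    have "(\<Sum>l<n. B $$ (j, l) * (\<Sum>i<n. A $$ (l, i) * x i))
        = (\<Sum>l<n. \<Sum>i<n. B $$ (j, l) * A $$ (l, i) * x i)"
      by (simp add: sum_distrib_left mult.assoc)
    also have "\<dots> = (\<Sum>i<n. (\<Sum>l<n. B $$ (j, l) * A $$ (l, i)) * x i)"
      by (subst sum.swap) (simp add: sum_distrib_right)
    also have "\<dots> = (\<Sum>i<n. if i = j then x i else 0)"
      by (intro sum.cong) (auto simp: entry)
    also have "\<dots> = x j" using j by simp
    finally show ?thesis .
  qed
  then show ?thesis by blast
qed

text \<open>Columns of a transpose are rows of the original, so each column of the block matrix
  belongs to one source process. The list of pairs \<open>(S, k)\<close> names these columns in
  order and thus serves as their index.\<close>

lemma transposed_blocks_rows: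
  assumes "\<And>S. S \<in> set Ss \<Longrightarrow> dim_row (M S) = m S"
  shows "transposed_blocks n (map M Ss) = mat_of_cols n
    (map (\<lambda>(S, k). row (M S) k) (concat (map (\<lambda>S. map (Pair S) [0..<m S]) Ss)))"
proof -
  have "concat (map (\<lambda>S. rows (M S)) Ss)
      = map (\<lambda>(S, k). row (M S) k) (concat (map (\<lambda>S. map (Pair S) [0..<m S]) Ss))"
    using assms by (induction Ss) (auto simp: rows_def)
  then show ?thesis by (simp add: transposed_blocks_def comp_def)
qed

lemma finite_connection_set:
  assumes "is_network G" "connection_set G C"
  shows "finite C"
proof -
  have "finite (sources G)" "finite (dests G)"
    using assms(1) by (auto simp: is_network_def intro: finite_subset)
  then have "finite (sources G \<times> dests G \<times> (\<Union>S\<in>sources G. Pow {..<mu G S}))" by simp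
  moreover have "C \<subseteq> sources G \<times> dests G \<times> (\<Union>S\<in>sources G. Pow {..<mu G S})"
    
  proof
    fix x assume x: "x \<in> C"
    obtain S T A where STA: "x = (S, T, A)" by (rule prod_cases3)
    then have "S \<in> sources G" "T \<in> dests G" "A \<subseteq> {..<mu G S}"
      using assms(2) x by (auto simp: connection_set_def)
    then show "x \<in> sources G \<times> dests G \<times> (\<Union>S\<in>sources G. Pow {..<mu G S})"
      using STA by blast
  qed
  ultimately show ?thesis by (rule finite_subset[rotated])
qed

text \<open>The symbols at \<open>T\<close> are the block matrix applied to the processes of
  \<open>Ss\<close> written as one vector, and \<open>B\<close> is its inverse. One \<open>B\<close>
  serves all these processes and all symbol values.\<close>

lemma decoding_at_dest:
  fixes c :: "('v, 'p, 'f::{finite, field}) coeffs"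
  assumes G: "is_network G" and M: "system_matrices G c M" and T: "T \<in> dests G"
    and Ss: "distinct Ss" "set Ss \<subseteq> sources G"
    and zero: "\<And>S. S \<in> sources G \<Longrightarrow> S \<notin> set Ss \<Longrightarrow> M S T = 0\<^sub>m (mu G S) (nu c T)"
    and car: "transposed_blocks (nu c T) (map (\<lambda>S. M S T) Ss) \<in> carrier_mat (nu c T) (nu c T)"
    and inv: "invertible_mat (transposed_blocks (nu c T) (map (\<lambda>S. M S T) Ss))"
  shows "\<exists>B. \<forall>S\<in>set Ss. \<forall>k<mu G S. \<exists>j<nu c T. \<forall>X Y. transmission G c X Y \<longrightarrow>
    (\<Sum>l<nu c T. B $$ (j, l) * dest_symbol G c Y T l) = X S k"
proof -
  define P where "P = concat (map (\<lambda>S. map (Pair S) [0..<mu G S]) Ss)"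
  define A where "A = transposed_blocks (nu c T) (map (\<lambda>S. M S T) Ss)"
  let ?n = "nu c T"
  have fin: "finite (sources G)" using G by (auto simp: is_network_def intro: finite_subset)
  have dim: "M S T \<in> carrier_mat (mu G S) ?n" if "S \<in> sources G" for S
    using M T that by (auto simp: system_matrices_def)
  have A: "A = mat_of_cols ?n (map (\<lambda>(S, k). row (M S T) k) P)"
    unfolding A_def P_def
    by (rule transposed_blocks_rows) (use dim Ss in auto)
  \<comment> \<open>Squareness of the block matrix says that there are as many processes in
    \<open>P\<close> as components at \<open>T\<close>.\<close>
  then have len: "length P = ?n" using car unfolding A_def[symmetric] by auto
  have setP: "set P = (SIGMA S:set Ss. {..<mu G S})" by (auto simp: P_def)
  \<comment> \<open>Both sides are the sum of \<open>mu G S\<close> over \<open>set Ss\<close>,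
    since \<open>Ss\<close> is distinct.\<close>
  have "length P = card (set P)"
    unfolding setP using Ss
    by (simp add: P_def length_concat comp_def sum_list_distinct_conv_sum_set)
  then have distP: "distinct P" by (simp add: card_distinct)
  obtain B where B: "\<And>x j. j < ?n \<Longrightarrow> (\<Sum>l<?n. B $$ (j, l) * (\<Sum>i<?n. A $$ (l, i) * x i)) = x j"
    using invertible_mat_solve[of A ?n] car inv unfolding A_def by blast
  have Z: "dest_symbol G c Y T l = (\<Sum>i<?n. A $$ (l, i) * case_prod X (P ! i))"
    if Y: "transmission G c X Y" and l: "l < ?n" for X Y l
  proof -
    have "dest_symbol G c Y T l = (\<Sum>S\<in>sources G. \<Sum>k<mu G S. X S k * M S T $$ (k, l))"
      using M Y T l by (auto simp: system_matrices_def)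
    also have "\<dots> = (\<Sum>S\<in>set Ss. \<Sum>k<mu G S. X S k * M S T $$ (k, l))"
      using fin Ss(2) l zero by (intro sum.mono_neutral_right) auto
    also have "\<dots> = (\<Sum>(S, k)\<in>set P. X S k * M S T $$ (k, l))"
      by (simp add: setP sum.Sigma)
    \<comment> \<open>As \<open>P\<close> is distinct of length \<open>?n\<close>, its positions are
      in bijection with \<open>set P\<close>.\<close>
    also have "\<dots> = (\<Sum>i<?n. (case P ! i of (S, k) \<Rightarrow> X S k * M S T $$ (k, l)))"
      by (rule sum.reindex_bij_betw[symmetric])
        (rule bij_betw_nth, use distP len in auto)
    also have "\<dots> = (\<Sum>i<?n. A $$ (l, i) * case_prod X (P ! i))"
    proof (rule sum.cong)
      fix i assume "i \<in> {..<?n}"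
      then have i: "i < length P" using len by simp
      obtain S k where Sk: "P ! i = (S, k)" by force
      then have "(S, k) \<in> set P" using i by (metis nth_mem)
      then have "S \<in> sources G" "k < mu G S" using setP Ss(2) by auto
      then have "A $$ (l, i) = M S T $$ (k, l)"
        using dim[of S] i l Sk by (auto simp: A mat_of_cols_index)
      then show "(case P ! i of (S, k) \<Rightarrow> X S k * M S T $$ (k, l)) = A $$ (l, i) * case_prod X (P ! i)"
        by (simp add: Sk)
    qed simp
    finally show ?thesis .
  qed
  have "\<exists>j<?n. \<forall>X Y. transmission G c X Y \<longrightarrow>
      (\<Sum>l<?n. B $$ (j, l) * dest_symbol G c Y T l) = X S k"
    if "S \<in> set Ss" "k < mu G S" for S k
  proof -
    have "(S, k) \<in> set P" using that setP by auto
    \<comment> \<open>The process reappears at its own position in \<open>P\<close>, which is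
      independent of the symbol values.\<close>
    then obtain j where j: "j < ?n" "P ! j = (S, k)" using len by (metis in_set_conv_nth)
    have "(\<Sum>l<?n. B $$ (j, l) * dest_symbol G c Y T l) = X S k" if "transmission G c X Y" for X Y
      using B[OF j(1), of "\<lambda>i. case_prod X (P ! i)"] Z[OF that] j(2) by simp
    then show ?thesis using j(1) by blast
  qed
  then show ?thesis by blast
qed

theorem theorem10:
  fixes G :: "('v, 'p) network"
    and C :: "'v connection set"
  assumes "acyclic_network G"
    and "connection_set G C"
    and "\<exists>(c :: ('v, 'p, 'f::{finite, field}) coeffs) M.
      system_matrices G c M \<and>
      (\<forall>S\<in>sources G. \<forall>T\<in>dests G. (\<nexists>A. (S, T, A) \<in> C) \<longrightarrow> M S T = 0\<^sub>m (mu G S) (nu c T)) \<and>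
      (\<forall>T\<in>dests G. \<forall>cs. distinct cs \<and> set cs = {x \<in> C. fst (snd x) = T} \<longrightarrow>
         transposed_blocks (nu c T) (map (\<lambda>x. M (fst x) T) cs) \<in> carrier_mat (nu c T) (nu c T) \<and>
         invertible_mat (transposed_blocks (nu c T) (map (\<lambda>x. M (fst x) T) cs)))"
  shows "solvable TYPE('f) G C"
proof -
  have net: "is_network G" using assms(1) by (simp add: acyclic_network_def)
  obtain c :: "('v, 'p, 'f) coeffs" and M where M: "system_matrices G c M"
    and zero: "\<And>S T. S \<in> sources G \<Longrightarrow> T \<in> dests G \<Longrightarrow> \<nexists>A. (S, T, A) \<in> C \<Longrightarrow>
      M S T = 0\<^sub>m (mu G S) (nu c T)"
    and blocks: "\<And>T cs. T \<in> dests G \<Longrightarrow> distinct cs \<Longrightarrow> set cs = {x \<in> C. fst (snd x) = T} \<Longrightarrow>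
      transposed_blocks (nu c T) (map (\<lambda>x. M (fst x) T) cs) \<in> carrier_mat (nu c T) (nu c T) \<and>
      invertible_mat (transposed_blocks (nu c T) (map (\<lambda>x. M (fst x) T) cs))"
    using assms(3) by (elim exE conjE) simp
  let ?decodes = "\<lambda>B S T k. \<exists>j<nu c T. \<forall>X Y. transmission G c X Y \<longrightarrow>
      (\<Sum>l<nu c T. B $$ (j, l) * dest_symbol G c Y T l) = X S k"
  have "\<forall>T\<in>dests G. \<exists>B. \<forall>S A. (S, T, A) \<in> C \<longrightarrow> (\<forall>k<mu G S. ?decodes B S T k)"
  proof
    fix T assume T: "T \<in> dests G"
    \<comment> \<open>Condition 2 ranges over all enumerations of the connections into
      \<open>T\<close>; finiteness of \<open>C\<close> provides one.\<close>
    obtain cs where cs: "distinct cs" "set cs = {x \<in> C. fst (snd x) = T}"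
      using finite_distinct_list[of "{x \<in> C. fst (snd x) = T}"]
        finite_connection_set[OF net assms(2)] by auto
    \<comment> \<open>At most one connection exists per source and destination, so no source is
      repeated among the blocks.\<close>
    have "inj_on fst (set cs)"
      using assms(2) cs(2) unfolding connection_set_def inj_on_def by auto
    then have dist: "distinct (map fst cs)" using cs(1) by (simp add: distinct_map)
    have sub: "set (map fst cs) \<subseteq> sources G"
      using assms(2) cs(2) unfolding connection_set_def by auto
    have iff: "S \<in> set (map fst cs) \<longleftrightarrow> (\<exists>A. (S, T, A) \<in> C)" for S
      using cs(2) by force
    have "\<exists>B. \<forall>S\<in>set (map fst cs). \<forall>k<mu G S. ?decodes B S T k"
    proof (rule decoding_at_dest[OF net M T dist sub])
      show "M S T = 0\<^sub>m (mu G S) (nu c T)" if "S \<in> sources G" "S \<notin> set (map fst cs)" for S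
        using zero[OF that(1) T] that(2) iff by blast
    qed (use blocks[OF T cs] in \<open>simp_all add: comp_def\<close>)
    then obtain B where B: "\<forall>S\<in>set (map fst cs). \<forall>k<mu G S. ?decodes B S T k" ..
    have "?decodes B S T k" if "(S, T, A) \<in> C" "k < mu G S" for S A k
    proof -
      have "S \<in> set (map fst cs)" using that(1) iff by blast
      then show ?thesis using B that(2) by (elim ballE allE impE) auto
    qed
    then show "\<exists>B. \<forall>S A. (S, T, A) \<in> C \<longrightarrow> (\<forall>k<mu G S. ?decodes B S T k)"
      by (intro exI[of _ B] allI impI)
  qed
  \<comment> \<open>Each destination may use its own decoding matrix, because its \<open>eps\<close>
    coefficients affect no other destination.\<close>
  from bchoice[OF this] obtain B where
    B: "\<forall>T\<in>dests G. \<forall>S A. (S, T, A) \<in> C \<longrightarrow> (\<forall>k<mu G S. ?decodes (B T) S T k)" ..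
  \<comment> \<open>The product with \<open>B T\<close> is absorbed into the decoding coefficients.
    As \<open>alpha\<close>, \<open>beta\<close> and \<open>nu\<close> are kept, the port symbols
    and the number of components stay the same.\<close>
  define c' where "c' = c\<lparr>eps := \<lambda>e T j. \<Sum>l<nu c T. B T $$ (j, l) * eps c e T l\<rparr>"
  have nu: "nu c' = nu c" by (simp add: c'_def)
  have trans: "transmission G c' X Y \<longleftrightarrow> transmission G c X Y" for X Y
    by (simp add: transmission_def c'_def)
  have dest: "dest_symbol G c' Y T j = (\<Sum>l<nu c T. B T $$ (j, l) * dest_symbol G c Y T l)" for Y T j
    unfolding dest_symbol_def c'_def
    by (simp add: sum_distrib_left sum_distrib_right mult.assoc) (rule sum.swap)
  have "established G c' (S, T, A)" if con: "(S, T, A) \<in> C" for S T A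
  proof -
    have T: "T \<in> dests G" and A: "A \<subseteq> {..<mu G S}"
      using assms(2) con unfolding connection_set_def by auto
    have "?decodes (B T) S T k" if "k \<in> A" for k
      using B[rule_format, OF T con, of k] A that by blast
    then show ?thesis by (simp add: nu trans dest)
  qed
  then have "\<forall>x\<in>C. established G c' x" by auto
  then show ?thesis unfolding solvable_def by blast
qed

end
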